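(* Let $F$ be any one of the faces $(\hat U_{3,5}^{1},U_{1,1}^{1})$, $(\hat U_{3,5}^{1},U_{1,1}^{2})$, $(\hat U_{3,5}^{1},U_{1,2}^{12})$ of $\Gamma_4$. For real $a,b\ge 0$, the point $\mathbf h=(a,b)\in F$ is entropic if and only if $a=\log v$ for some integer $v\ge 1$.
   Context: $N_4=\{1,2,3,4\}$. $\Gamma_4$ is the cone of all polymatroid rank functions on $N_4$. A set function $\mathbf h:2^{N_4}\to\mathbb R$ is called entropic if there is a random vector $(X_1,X_2,X_3,X_4)$, each $X_i$ taking values in a finite set, with $\mathbf h(A)=H(X_A)$ for all $A\subseteq N_4$, where $H$ is Shannon entropy, $X_A=(X_j,j\in A)$ and $\mathbf h(\emptyset)=0$. Logarithms (also in the entropy) are to base $2$. For two (poly)matroids $M_1,M_2$ on $N_4$ with rank functions $\mathbf r_1,\mathbf r_2$, $(M_1,M_2)$ denotes the face $\{a\mathbf r_1+b\mathbf r_2:a,b\ge0\}$ of $\Gamma_4$, and $(a,b)$ denotes the point $a\mathbf r_1+b\mathbf r_2$. For $\alpha\subseteq N_4$ with $|\alpha|=m$, $U^\alpha_{k,m}$ is the matroid on $N_4$ with rank function $\mathbf r(A)=\min\{k,|A\cap\alpha|\}$. $\hat U^1_{3,5}$ is the integer polymatroid on $N_4$ with rank function $\mathbf r(A)=\min\{3,|A|+1\}$ if $1\in A$ and $\mathbf r(A)=|A|$ if $1\notin A$. Superscripts such as $12$ abbreviate $\{1,2\}$. *)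

theory Defs
  imports "HOL-Probability.Probability"
begin

abbreviation N4 :: "nat set" where
  "N4 \<equiv> {1, 2, 3, 4}"

text \<open>Set functions on the subsets of \<open>N4\<close> have type \<open>nat set \<Rightarrow> real\<close>; only their values
  on subsets of \<open>N4\<close> are relevant.\<close>

definition subvector :: "(nat \<Rightarrow> 'a \<Rightarrow> 'b) \<Rightarrow> nat set \<Rightarrow> 'a \<Rightarrow> nat \<Rightarrow> 'b" where
  "subvector X A \<omega> = (\<lambda>i\<in>A. X i \<omega>)"

text \<open>The reference measure is counting measure on the range, as in the notation \<open>\<H>(X)\<close> of
  the locale \<open>information_space\<close>, so this is discrete Shannon entropy in bits.\<close>

definition shannon_entropy :: "'a measure \<Rightarrow> ('a \<Rightarrow> 'b) \<Rightarrow> real" where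
  "shannon_entropy M X = prob_space.entropy M 2 (count_space (X ` space M)) X"

definition entropy_function_of :: "'a measure \<Rightarrow> (nat \<Rightarrow> 'a \<Rightarrow> 'b) \<Rightarrow> (nat set \<Rightarrow> real) \<Rightarrow> bool" where
  "entropy_function_of M X h \<longleftrightarrow>
     prob_space M \<and> (\<forall>i\<in>N4. simple_function M (X i)) \<and>
     (\<forall>A\<subseteq>N4. h A = shannon_entropy M (subvector X A))"

text \<open>HOL cannot quantify over the type of the sample space or of the values. Fixing both to be
  \<open>nat\<close> loses no generality; see \<open>entropy_function_of_imp_entropic\<close> below.\<close>

definition entropic :: "(nat set \<Rightarrow> real) \<Rightarrow> bool" where
  "entropic h \<longleftrightarrow> (\<exists>(M :: nat measure) (X :: nat \<Rightarrow> nat \<Rightarrow> nat). entropy_function_of M X h)"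

text \<open>The rank function of $U^\alpha_{k,m}$, where $m$ is the cardinality of $\alpha$.\<close>

definition uniform_rank :: "nat \<Rightarrow> nat set \<Rightarrow> nat set \<Rightarrow> real" where
  "uniform_rank k \<alpha> A = real (min k (card (A \<inter> \<alpha>)))"

text \<open>The rank function of $\hat U^i_{3,5}$.\<close>

definition Uhat35_rank :: "nat \<Rightarrow> nat set \<Rightarrow> real" where
  "Uhat35_rank i A = real (if i \<in> A then min 3 (card A + 1) else card A)"

definition face_point :: "(nat set \<Rightarrow> real) \<Rightarrow> (nat set \<Rightarrow> real) \<Rightarrow> real \<Rightarrow> real \<Rightarrow> nat set \<Rightarrow> real" where
  "face_point r1 r2 a b A = a * r1 A + b * r2 A"

lemma simple_function_subvector:
  assumes "finite A" "\<And>i. i \<in> A \<Longrightarrow> simple_function M (X i)"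
  shows "simple_function M (subvector X A)"
  using assms
proof (induction A rule: finite_induct)
  case empty
  then show ?case by (simp add: subvector_def[abs_def] restrict_def)
next
  case (insert j A)
  have "simple_function M (\<lambda>\<omega>. (X j \<omega>, subvector X A \<omega>))"
    using insert by (intro simple_function_Pair) auto
  from simple_function_compose1[OF this, of "\<lambda>(x, v). v(j := x)"]
  have "simple_function M (\<lambda>\<omega>. (subvector X A \<omega>)(j := X j \<omega>))" by simp
  also have "(\<lambda>\<omega>. (subvector X A \<omega>)(j := X j \<omega>)) = subvector X (insert j A)"
    by (auto simp: subvector_def fun_eq_iff)
  finally show ?case .
qed

lemma entropy_function_of_imp_entropic:
  fixes M :: "'a measure" and X :: "nat \<Rightarrow> 'a \<Rightarrow> 'b"
  assumes "entropy_function_of M X h"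
  shows "entropic h"
proof -
  interpret prob_space M using assms by (simp add: entropy_function_of_def)
  interpret information_space M 2 by unfold_locales simp
  have X: "simple_function M (X i)" if "i \<in> N4" for i
    using assms that unfolding entropy_function_of_def by blast
  have XA: "simple_function M (subvector X A)" if "A \<subseteq> N4" for A
    
  proof (rule simple_function_subvector)
    show "finite A" by (rule finite_subset[OF that]) simp
    show "simple_function M (X i)" if "i \<in> A" for i
      using X \<open>A \<subseteq> N4\<close> that by blast
  qed
  define R where "R = subvector X N4 ` space M"
  have fR: "finite R" unfolding R_def by (rule simple_functionD(1)[OF XA]) simp
  obtain g :: "(nat \<Rightarrow> 'b) \<Rightarrow> nat" where g: "inj_on g R"
    using finite_imp_inj_to_nat_seg[OF fR] by blast
  have "finite (\<Union>i\<in>N4. X i ` space M)"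
    by (rule finite_UN_I, simp, rule simple_functionD(1)[OF X])
  then obtain c :: "'b \<Rightarrow> nat" where c: "inj_on c (\<Union>i\<in>N4. X i ` space M)"
    by (metis finite_imp_inj_to_nat_seg)
  define T where "T = g \<circ> subvector X N4"
  define K where "K = count_space (T ` space M)"
  define N where "N = distr M K T"
  define Y where "Y = (\<lambda>i n. c (inv_into R g n i))"
  have T: "T \<in> measurable M K"
    unfolding T_def K_def
    using simple_function_compose[OF XA[of N4], of g]
    by (auto simp: simple_function_def measurable_count_space_eq2)
  have N: "prob_space N" unfolding N_def by (rule prob_space_distr[OF T])
  have spN: "space N = T ` space M" by (simp add: N_def K_def)
  have YT: "Y i (T \<omega>) = c (X i \<omega>)" if "i \<in> N4" "\<omega> \<in> space M" for i \<omega>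
    using that g by (simp add: Y_def T_def R_def inv_into_f_f) (auto simp: subvector_def)
  have fT: "finite (T ` space M)"
    using finite_imageI[OF fR, of g] by (simp add: T_def R_def image_image comp_def)
  have Y: "simple_function N (Y i)" for i
    using fT by (auto simp: simple_function_def spN N_def K_def)
  have "shannon_entropy N (subvector Y A) = shannon_entropy M (subvector X A)" if A: "A \<subseteq> N4" for A
  proof -
    let ?f = "\<lambda>v. \<lambda>i\<in>A. c (v i)"
    have eq: "subvector Y A (T \<omega>) = (?f \<circ> subvector X A) \<omega>" if "\<omega> \<in> space M" for \<omega>
      using that A YT by (auto simp: subvector_def fun_eq_iff)
    have im: "subvector Y A ` space N = (?f \<circ> subvector X A) ` space M"
      unfolding spN image_image using eq by (intro image_cong) auto
    let ?S = "count_space (subvector Y A ` space N)"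
    have "distr N ?S (subvector Y A) = distr M ?S (subvector Y A \<circ> T)"
      unfolding N_def by (rule distr_distr) (use T in \<open>auto simp: N_def K_def\<close>)
    also have "\<dots> = distr M ?S (?f \<circ> subvector X A)"
      using eq by (intro distr_cong) auto
    finally have "shannon_entropy N (subvector Y A) = shannon_entropy M (?f \<circ> subvector X A)"
      by (simp only: shannon_entropy_def prob_space.entropy_def[OF N] entropy_def im)
    also have "inj_on ?f (subvector X A ` space M)"
    proof (rule inj_onI; clarify)
      fix x y assume xy: "x \<in> space M" "y \<in> space M" "?f (subvector X A x) = ?f (subvector X A y)"
      have "X i x = X i y" if i: "i \<in> A" for i
      proof (rule inj_onD[OF c])
        show "c (X i x) = c (X i y)"
          using fun_cong[OF xy(3), of i] i by (simp add: subvector_def)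
      qed (rule UN_I[OF subsetD[OF A i]], rule imageI, rule xy)+
      then show "subvector X A x = subvector X A y"
        by (auto simp: subvector_def fun_eq_iff)
    qed
    then have "shannon_entropy M (?f \<circ> subvector X A) = shannon_entropy M (subvector X A)"
      unfolding shannon_entropy_def by (rule entropy_of_inj[OF XA[OF A]])
    finally show ?thesis .
  qed
  then have "entropy_function_of N Y h"
    using assms N Y by (simp add: entropy_function_of_def)
  then show ?thesis unfolding entropic_def by blast
qed

end

(* Only if: the argument only sees X_1, X_3, X_4. The rank function makes X_1, X_3, X_4 pairwise
   independent, and makes any two of them that include X_1 determine the third. These relations
   force X_3 to be uniform on its support, so a = H(X_3) = log v.
   If: let X_2, X_3, X_4 be independent and uniform on Z/v, and X_1 = (X_2 - X_3, X_2 - X_4). Then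
   H(X_A) = r(A) log v for the rank function r of Uhat, for every v. Adjoining one independent
   variable of entropy b to each X_i with i in E adds b times the rank-one uniform matroid on E,
   where E is {1}, {2} or {1, 2}. *)

theory Submission
  imports Defs "HOL-Real_Asymp.Real_Asymp"
begin

section \<open>Entropy equalities force uniformity\<close>

text \<open>Since ln x \<le> x - 1 with equality only at x = 1, each term
  \<open>p t * ln (q t / p t)\<close> is at most \<open>q t - p t\<close>, strictly when the two
  weights differ. These bounds sum to at most 0 by \<open>le\<close>, so a vanishing sum leaves no
  room for a strict term. The hypothesis \<open>ac\<close> excludes \<open>q t = 0 < p t\<close>,
  where the logarithm would be taken at 0.\<close>

lemma gibbs_equality:
  fixes p q :: "'a \<Rightarrow> real"
  assumes fin: "finite S"
    and p: "\<And>s. s \<in> S \<Longrightarrow> 0 \<le> p s" and q: "\<And>s. s \<in> S \<Longrightarrow> 0 \<le> q s"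
    and ac: "\<And>s. s \<in> S \<Longrightarrow> q s = 0 \<Longrightarrow> p s = 0"
    and le: "sum q S \<le> sum p S"
    and eq: "(\<Sum>s\<in>S. p s * ln (q s / p s)) = 0"
    and s: "s \<in> S"
  shows "p s = q s"
proof -
  have strict: "p t * ln (q t / p t) < q t - p t" if t: "t \<in> S" "p t \<noteq> q t" for t
  proof (cases "p t = 0")
    case False
    then have pos: "0 < p t" "0 < q t"
      using p[OF t(1)] q[OF t(1)] ac[OF t(1)] by (auto simp: less_le)
    then have "ln (q t / p t) < q t / p t - 1"
      using t(2) ln_eq_minus_one[of "q t / p t"] ln_le_minus_one[of "q t / p t"]
      by (fastforce simp: less_le)
    then have "p t * ln (q t / p t) < p t * (q t / p t - 1)"
      using pos by (intro mult_strict_left_mono)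
    then show ?thesis using pos by (simp add: right_diff_distrib)
  qed (use t q[OF t(1)] in auto)
  then have weak: "p t * ln (q t / p t) \<le> q t - p t" if "t \<in> S" for t
    using that by (cases "p t = q t") (auto intro: less_imp_le)
  show ?thesis
  proof (rule ccontr)
    assume "p s \<noteq> q s"
    with fin s strict weak have "(\<Sum>t\<in>S. p t * ln (q t / p t)) < (\<Sum>t\<in>S. q t - p t)"
      by (intro sum_strict_mono_ex1) auto
    with le eq show False by (simp add: sum_subtractf)
  qed
qed

section \<open>Marginals and entropies as finite sums\<close>

context information_space
begin

abbreviation pr :: "('a \<Rightarrow> 'b) \<Rightarrow> 'b \<Rightarrow> real" where
  "pr X x \<equiv> prob {\<omega> \<in> space M. X \<omega> = x}"

lemma vimage_singleton_eq: "X -` {x} \<inter> space M = {\<omega> \<in> space M. X \<omega> = x}"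
  by auto

lemma pr_outside: "x \<notin> X ` space M \<Longrightarrow> pr X x = 0"
  by (rule trans[OF arg_cong[where f = prob and y = "{}"]]) auto

lemma simple_function_event:
  "simple_function M X \<Longrightarrow> {\<omega> \<in> space M. X \<omega> = x} \<in> events"
  using simple_functionD(2)[of M X "{x}"] by (simp add: vimage_singleton_eq)

text \<open>Values outside the range have probability 0 and contribute 0 to the sum. The freedom in
  \<open>S\<close> matters for pairs, whose range may be a proper subset of the product of the
  ranges.\<close>

lemma entropy_eq_sum:
  assumes X: "simple_function M X" and S: "finite S" "X ` space M \<subseteq> S"
  shows "\<H>(X) = - (\<Sum>x\<in>S. pr X x * log b (pr X x))"
proof -
  have "\<H>(X) = - (\<Sum>x\<in>X ` space M. pr X x * log b (pr X x))"
    using entropy_simple_distributed[OF simple_distributedI[OF X measure_nonneg refl]]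
    by (simp add: vimage_singleton_eq)
  also have "(\<Sum>x\<in>X ` space M. pr X x * log b (pr X x)) = (\<Sum>x\<in>S. pr X x * log b (pr X x))"
    using S by (intro sum.mono_neutral_left) (auto simp: pr_outside)
  finally show ?thesis .
qed

lemma sum_pr:
  assumes X: "simple_function M X" and Y: "simple_function M Y"
  shows "(\<Sum>y\<in>Y ` space M. pr (\<lambda>\<omega>. (X \<omega>, Y \<omega>)) (x, y)) = pr X x"
proof -
  have "(\<Sum>y\<in>Y ` space M. pr (\<lambda>\<omega>. (X \<omega>, Y \<omega>)) (x, y))
      = prob (\<Union>y\<in>Y ` space M. {\<omega> \<in> space M. (X \<omega>, Y \<omega>) = (x, y)})"
    using simple_functionD(1)[OF Y] simple_function_event[OF simple_function_Pair[OF X Y]]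
    by (intro finite_measure_finite_Union[symmetric]) (auto simp: disjoint_family_on_def)
  also have "(\<Union>y\<in>Y ` space M. {\<omega> \<in> space M. (X \<omega>, Y \<omega>) = (x, y)}) = {\<omega> \<in> space M. X \<omega> = x}"
    by auto
  finally show ?thesis .
qed

lemma pr_swap: "pr (\<lambda>\<omega>. (X \<omega>, Y \<omega>)) (x, y) = pr (\<lambda>\<omega>. (Y \<omega>, X \<omega>)) (y, x)"
  by (rule arg_cong[where f = prob]) auto

lemma sum_pr':
  assumes X: "simple_function M X" and Y: "simple_function M Y"
  shows "(\<Sum>x\<in>X ` space M. pr (\<lambda>\<omega>. (X \<omega>, Y \<omega>)) (x, y)) = pr Y y"
  using sum_pr[OF Y X, of y] by (simp only: pr_swap[of X Y])

lemma sum_pr_eq_1: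
  assumes X: "simple_function M X"
  shows "(\<Sum>x\<in>X ` space M. pr X x) = 1"
  using simple_distributed_sum_space[OF simple_distributedI[OF X measure_nonneg refl]]
  by (simp add: vimage_singleton_eq)

lemma pr_pair_le:
  assumes X: "simple_function M X"
  shows "pr (\<lambda>\<omega>. (X \<omega>, Y \<omega>)) (x, y) \<le> pr X x"
  by (rule finite_measure_mono) (auto intro: simple_function_event X)

lemma pr_pair_le':
  assumes Y: "simple_function M Y"
  shows "pr (\<lambda>\<omega>. (X \<omega>, Y \<omega>)) (x, y) \<le> pr Y y"
  by (rule finite_measure_mono) (auto intro: simple_function_event Y)

text \<open>Marginalization. Together with the next two lemmas it puts all three entropies on one
  index set with the same joint weights, so that their differences can be studied term by
  term.\<close>

lemma entropy_fst_eq_sum: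
  assumes X: "simple_function M X" and Y: "simple_function M Y"
  shows "\<H>(X) = - (\<Sum>(x, y)\<in>X ` space M \<times> Y ` space M.
            pr (\<lambda>\<omega>. (X \<omega>, Y \<omega>)) (x, y) * log b (pr X x))"
proof -
  have "\<H>(X) = - (\<Sum>x\<in>X ` space M. (\<Sum>y\<in>Y ` space M. pr (\<lambda>\<omega>. (X \<omega>, Y \<omega>)) (x, y)) * log b (pr X x))"
    unfolding sum_pr[OF X Y] by (rule entropy_eq_sum[OF X simple_functionD(1)[OF X] order_refl])
  then show ?thesis by (simp only: sum_distrib_right sum.cartesian_product)
qed

lemma entropy_snd_eq_sum:
  assumes X: "simple_function M X" and Y: "simple_function M Y"
  shows "\<H>(Y) = - (\<Sum>(x, y)\<in>X ` space M \<times> Y ` space M.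
            pr (\<lambda>\<omega>. (X \<omega>, Y \<omega>)) (x, y) * log b (pr Y y))"
proof -
  have "\<H>(Y) = - (\<Sum>y\<in>Y ` space M. (\<Sum>x\<in>X ` space M. pr (\<lambda>\<omega>. (X \<omega>, Y \<omega>)) (x, y)) * log b (pr Y y))"
    unfolding sum_pr'[OF X Y] by (rule entropy_eq_sum[OF Y simple_functionD(1)[OF Y] order_refl])
  then show ?thesis
    by (subst sum.cartesian_product[symmetric], subst sum.swap) (simp only: sum_distrib_right)
qed

lemma entropy_pair_eq_sum:
  assumes X: "simple_function M X" and Y: "simple_function M Y"
  shows "\<H>(\<lambda>\<omega>. (X \<omega>, Y \<omega>)) = - (\<Sum>(x, y)\<in>X ` space M \<times> Y ` space M.
            pr (\<lambda>\<omega>. (X \<omega>, Y \<omega>)) (x, y) * log b (pr (\<lambda>\<omega>. (X \<omega>, Y \<omega>)) (x, y)))"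
proof -
  have "(\<lambda>\<omega>. (X \<omega>, Y \<omega>)) ` space M \<subseteq> X ` space M \<times> Y ` space M" by auto
  with simple_functionD(1)[OF X] simple_functionD(1)[OF Y] show ?thesis
    by (subst entropy_eq_sum[OF simple_function_Pair[OF X Y]])
      (simp_all only: finite_SigmaI case_prod_unfold prod.collapse)
qed

section \<open>Independence, functional dependence and uniformity from entropy equalities\<close>

text \<open>The mutual information is the relative entropy of the joint distribution with respect to
  the product of the marginals. It is 0 by \<open>H\<close>, so \<open>gibbs_equality\<close>
  identifies the two distributions.\<close>

lemma entropy_pair_additive_imp_product:
  assumes X: "simple_function M X" and Y: "simple_function M Y"
    and H: "\<H>(\<lambda>\<omega>. (X \<omega>, Y \<omega>)) = \<H>(X) + \<H>(Y)"
  shows "pr (\<lambda>\<omega>. (X \<omega>, Y \<omega>)) (x, y) = pr X x * pr Y y"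
proof (cases "(x, y) \<in> X ` space M \<times> Y ` space M")
  case False
  then have "pr X x * pr Y y = 0" using pr_outside[of x X] pr_outside[of y Y] by auto
  moreover have "pr (\<lambda>\<omega>. (X \<omega>, Y \<omega>)) (x, y) = 0" by (rule pr_outside) (use False in auto)
  ultimately show ?thesis by simp
next
  case True
  let ?S = "X ` space M \<times> Y ` space M" and ?P = "pr (\<lambda>\<omega>. (X \<omega>, Y \<omega>))"
  let ?Q = "\<lambda>s. pr X (fst s) * pr Y (snd s)"
  have "?P (x, y) = ?Q (x, y)"
  proof (rule gibbs_equality[where S = ?S and p = ?P and q = ?Q and s = "(x, y)"])
    show "finite ?S" by (intro finite_cartesian_product simple_functionD(1) X Y)
    show ac: "?Q s = 0 \<Longrightarrow> ?P s = 0" for s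
      using pr_pair_le[OF X, of Y "fst s" "snd s"] pr_pair_le'[OF Y, of X "fst s" "snd s"]
      by (auto simp: measure_le_0_iff)
    have "sum ?Q ?S = (\<Sum>x\<in>X ` space M. pr X x) * (\<Sum>y\<in>Y ` space M. pr Y y)"
      by (simp add: sum_product sum.cartesian_product case_prod_unfold)
    also have "\<dots> = 1" by (simp add: sum_pr_eq_1 X Y)
    also have "1 = (\<Sum>x\<in>X ` space M. \<Sum>y\<in>Y ` space M. ?P (x, y))"
      by (simp only: sum_pr[OF X Y] sum_pr_eq_1[OF X])
    also have "\<dots> = sum ?P ?S"
      by (simp only: sum.cartesian_product case_prod_unfold prod.collapse)
    finally show "sum ?Q ?S \<le> sum ?P ?S" by simp
    \<comment> \<open>The factor \<open>ln b\<close> changes natural logarithms to base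
      \<open>b\<close>. Where the joint probability is 0, both sides vanish through their factor
      \<open>?P s\<close>.\<close>
    have "?P s * ln (?Q s / ?P s)
        = ln b * (?P s * log b (pr X (fst s)) + ?P s * log b (pr Y (snd s)) - ?P s * log b (?P s))" for s
    proof (cases "?P s = 0")
      case False
      with ac[of s] have "pr X (fst s) \<noteq> 0" "pr Y (snd s) \<noteq> 0"
        by (metis mult_zero_left mult_zero_right)+
      with False have "0 < ?P s" "0 < pr X (fst s)" "0 < pr Y (snd s)"
        by (simp_all add: zero_less_measure_iff)
      with b_gt_1 show ?thesis
        by (simp add: log_def ln_div ln_mult field_simps)
    qed simp
    then have "(\<Sum>s\<in>?S. ?P s * ln (?Q s / ?P s))
        = ln b * (\<H>(\<lambda>\<omega>. (X \<omega>, Y \<omega>)) - \<H>(X) - \<H>(Y))"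
      unfolding entropy_fst_eq_sum[OF X Y] entropy_snd_eq_sum[OF X Y] entropy_pair_eq_sum[OF X Y]
        case_prod_unfold prod.collapse
      by (simp add: sum_distrib_left[symmetric] sum_subtractf sum.distrib)
    then show "(\<Sum>s\<in>?S. ?P s * ln (?Q s / ?P s)) = 0" by (simp add: H)
  qed (use True in auto)
  then show ?thesis by simp
qed

text \<open>The conditional entropy of Y given X is a sum of terms \<open>?d s\<close>, each
  nonnegative because a joint probability is at most its marginal. If the sum is 0, each term is 0,
  and the logarithm is injective on positive reals.\<close>

lemma entropy_pair_eq_imp_determined:
  assumes X: "simple_function M X" and Y: "simple_function M Y"
    and H: "\<H>(\<lambda>\<omega>. (X \<omega>, Y \<omega>)) = \<H>(X)"
    and pos: "pr (\<lambda>\<omega>. (X \<omega>, Y \<omega>)) (x, y) \<noteq> 0"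
  shows "pr (\<lambda>\<omega>. (X \<omega>, Y \<omega>)) (x, y) = pr X x"
proof -
  let ?S = "X ` space M \<times> Y ` space M" and ?P = "pr (\<lambda>\<omega>. (X \<omega>, Y \<omega>))"
  let ?d = "\<lambda>s. ?P s * (log b (pr X (fst s)) - log b (?P s))"
  have nonneg: "0 \<le> ?d s" for s
  proof (cases "?P s = 0")
    case False
    then have "0 < ?P s" by (simp add: zero_less_measure_iff)
    moreover have "?P s \<le> pr X (fst s)" using pr_pair_le[OF X, of Y "fst s" "snd s"] by simp
    ultimately show ?thesis using b_gt_1 by (intro mult_nonneg_nonneg) (auto simp: log_le_cancel_iff)
  qed simp
  have S: "finite ?S" by (intro finite_cartesian_product simple_functionD(1) X Y)
  have "(\<Sum>s\<in>?S. ?d s) = \<H>(\<lambda>\<omega>. (X \<omega>, Y \<omega>)) - \<H>(X)"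
    unfolding entropy_fst_eq_sum[OF X Y] entropy_pair_eq_sum[OF X Y] case_prod_unfold prod.collapse
    by (simp add: sum_subtractf right_diff_distrib)
  then have "\<forall>s\<in>?S. ?d s = 0"
    using sum_nonneg_eq_0_iff[OF S, of ?d] nonneg H by simp
  moreover have "(x, y) \<in> ?S"
    using pos pr_outside[of "(x, y)" "\<lambda>\<omega>. (X \<omega>, Y \<omega>)"] by blast
  ultimately have "?d (x, y) = 0" by blast
  with pos have "log b (pr X x) = log b (?P (x, y))" by simp
  moreover have "0 < ?P (x, y)" using pos by (simp add: zero_less_measure_iff)
  moreover have "0 < pr X x" using \<open>0 < ?P (x, y)\<close> pr_pair_le[OF X, of Y x y] by linarith
  ultimately show ?thesis using b_gt_1 by (simp add: log_def)
qed

text \<open>The witness v is the number of values of positive probability: normalization gives v * c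
  = 1, so v is nonzero and c = 1 / v.\<close>

lemma entropy_uniform_on_support:
  assumes X: "simple_function M X"
    and unif: "\<And>x. pr X x \<noteq> 0 \<Longrightarrow> pr X x = c"
  shows "\<exists>v::nat. 1 \<le> v \<and> \<H>(X) = log b (real v)"
proof -
  define S where "S = {x \<in> X ` space M. pr X x \<noteq> 0}"
  have S: "finite S" "S \<subseteq> X ` space M"
    using simple_functionD(1)[OF X] by (auto simp: S_def)
  have eq: "(\<Sum>x\<in>X ` space M. pr X x * f x) = (\<Sum>x\<in>S. c * f x)" for f :: "'b \<Rightarrow> real"
  proof -
    have "(\<Sum>x\<in>X ` space M. pr X x * f x) = (\<Sum>x\<in>S. pr X x * f x)"
      using simple_functionD(1)[OF X] S by (intro sum.mono_neutral_right) (auto simp: S_def)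
    also have "\<dots> = (\<Sum>x\<in>S. c * f x)"
      using unif by (intro sum.cong) (auto simp: S_def)
    finally show ?thesis .
  qed
  have one: "real (card S) * c = 1"
    using eq[of "\<lambda>_. 1"] sum_pr_eq_1[OF X] by simp
  then have card: "1 \<le> card S" by (cases "card S") auto
  have c: "c = 1 / real (card S)" using one card by (simp add: field_simps)
  have "\<H>(X) = - (\<Sum>x\<in>X ` space M. pr X x * log b (pr X x))"
    by (rule entropy_eq_sum[OF X simple_functionD(1)[OF X] order_refl])
  also have "\<dots> = - (\<Sum>x\<in>S. c * log b c)"
    unfolding eq using unif by (intro arg_cong[where f = uminus] sum.cong) (auto simp: S_def)
  also have "\<dots> = log b (real (card S))"
    using one card b_gt_1 by (simp add: c log_divide)
  finally show ?thesis using card by blast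
qed

text \<open>If B and C are independent, every pair (y, z) of values occurs together with some value x
  of A. Given A = x, the events B = y and C = z then coincide, so
  P(x) P(y) = P(x, y, z) = P(x) P(z), and P(y) = P(z).\<close>

lemma entropy_eq_log_nat:
  assumes A: "simple_function M A" and B: "simple_function M B" and C: "simple_function M C"
    and AB: "\<H>(\<lambda>\<omega>. (A \<omega>, B \<omega>)) = \<H>(A) + \<H>(B)"
    and AC: "\<H>(\<lambda>\<omega>. (A \<omega>, C \<omega>)) = \<H>(A) + \<H>(C)"
    and BC: "\<H>(\<lambda>\<omega>. (B \<omega>, C \<omega>)) = \<H>(B) + \<H>(C)"
    and ABC: "\<H>(\<lambda>\<omega>. ((A \<omega>, B \<omega>), C \<omega>)) = \<H>(\<lambda>\<omega>. (A \<omega>, B \<omega>))"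
    and ACB: "\<H>(\<lambda>\<omega>. ((A \<omega>, C \<omega>), B \<omega>)) = \<H>(\<lambda>\<omega>. (A \<omega>, C \<omega>))"
  shows "\<exists>v::nat. 1 \<le> v \<and> \<H>(B) = log b (real v)"
proof -
  note sf = simple_function_Pair
  have eq: "pr B y = pr C z" if y: "pr B y \<noteq> 0" and z: "pr C z \<noteq> 0" for y z
  proof -
    let ?P = "pr (\<lambda>\<omega>. (A \<omega>, B \<omega>, C \<omega>))"
    have "(\<Sum>x\<in>A ` space M. ?P (x, y, z)) = pr B y * pr C z"
      by (simp only: sum_pr'[OF A sf[OF B C]] entropy_pair_additive_imp_product[OF B C BC])
    with y z have "(\<Sum>x\<in>A ` space M. ?P (x, y, z)) \<noteq> 0" by simp
    then obtain x where x: "?P (x, y, z) \<noteq> 0" by (meson sum.not_neutral_contains_not_neutral)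
    \<comment> \<open>One event, bracketed in two ways so that the determining pair comes
      first.\<close>
    have xyz: "?P (x, y, z) = pr (\<lambda>\<omega>. ((A \<omega>, B \<omega>), C \<omega>)) ((x, y), z)"
      "?P (x, y, z) = pr (\<lambda>\<omega>. ((A \<omega>, C \<omega>), B \<omega>)) ((x, z), y)"
      by (auto intro!: arg_cong[where f = prob])
    have "?P (x, y, z) = pr A x * pr B y"
      using entropy_pair_eq_imp_determined[OF sf[OF A B] C ABC, of "(x, y)" z] x xyz
        entropy_pair_additive_imp_product[OF A B AB, of x y] by simp
    moreover have "?P (x, y, z) = pr A x * pr C z"
      using entropy_pair_eq_imp_determined[OF sf[OF A C] B ACB, of "(x, z)" y] x xyz
        entropy_pair_additive_imp_product[OF A C AC, of x z] by simp
    ultimately show ?thesis using x by auto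
  qed
  \<comment> \<open>A single value z of positive probability provides the constant that all positive
    probabilities of B must equal.\<close>
  have "(\<Sum>z\<in>C ` space M. pr C z) \<noteq> 0" by (simp add: sum_pr_eq_1 C)
  then obtain z where "pr C z \<noteq> 0" by (meson sum.not_neutral_contains_not_neutral)
  with eq show ?thesis by (intro entropy_uniform_on_support[OF B, of "pr C z"]) blast
qed

end

section \<open>From the rank function to the entropy equalities\<close>

lemma shannon_entropy_of_inj:
  assumes "prob_space M" and X: "simple_function M X" and inj: "inj_on f (X ` space M)"
  shows "shannon_entropy M (\<lambda>\<omega>. f (X \<omega>)) = shannon_entropy M X"
proof -
  interpret prob_space M by fact
  interpret information_space M 2 by unfold_locales simp
  show ?thesis
    using entropy_of_inj[OF X inj] by (simp add: shannon_entropy_def comp_def)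
qed

text \<open>As \<open>E\<close> avoids 3 and 4, the second summand vanishes on {3}, {4} and {3, 4},
  and takes one common value on {1}, {1, 3}, {1, 4} and {1, 3, 4}. It therefore cancels from every
  equality required by \<open>entropy_eq_log_nat\<close>.\<close>

lemma entropic_imp_log_nat:
  assumes ent: "entropic (face_point (Uhat35_rank 1) (uniform_rank 1 E) a b)"
    and E: "3 \<notin> E" "4 \<notin> E"
  shows "\<exists>v::nat. 1 \<le> v \<and> a = log 2 (real v)"
proof -
  let ?h = "face_point (Uhat35_rank 1) (uniform_rank 1 E) a b"
  obtain M :: "nat measure" and X :: "nat \<Rightarrow> nat \<Rightarrow> nat" where MX: "entropy_function_of M X ?h"
    using ent unfolding entropic_def by blast
  interpret prob_space M using MX by (simp add: entropy_function_of_def)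
  interpret information_space M 2 by unfold_locales simp
  have X: "simple_function M (X i)" if "i \<in> N4" for i
    using MX that unfolding entropy_function_of_def by blast
  \<comment> \<open>Converts entropies of subvectors into entropies of tuples:
    \<open>PiE A (\<lambda>_. UNIV)\<close> contains the values of \<open>subvector X A\<close>, and
    reading off the components is injective on it.\<close>
  have H: "shannon_entropy M (\<lambda>\<omega>. f (subvector X A \<omega>)) = ?h A"
    if "A \<subseteq> N4" "inj_on f (PiE A (\<lambda>_. UNIV))" for A and f :: "(nat \<Rightarrow> nat) \<Rightarrow> 'd"
  proof -
    have fin: "finite A" by (rule finite_subset[OF that(1)]) simp
    have "shannon_entropy M (\<lambda>\<omega>. f (subvector X A \<omega>)) = shannon_entropy M (subvector X A)"
    proof (rule shannon_entropy_of_inj)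
      show "simple_function M (subvector X A)"
        using that(1) fin X by (intro simple_function_subvector) auto
      show "inj_on f (subvector X A ` space M)"
        by (rule inj_on_subset[OF that(2)]) (auto simp: subvector_def)
    qed (rule prob_space_axioms)
    also have "\<dots> = ?h A"
      using MX that(1) by (auto simp: entropy_function_of_def)
    finally show ?thesis .
  qed
  have inj1: "inj_on (\<lambda>g. g i) (PiE {i} (\<lambda>_. UNIV))" for i :: nat
    by (rule inj_onI, erule (1) PiE_ext) simp
  have inj2: "inj_on (\<lambda>g. (g i, g j)) (PiE {i, j} (\<lambda>_. UNIV))" for i j :: nat
    by (rule inj_onI, erule (1) PiE_ext) auto
  have inj3: "inj_on (\<lambda>g. ((g i, g j), g k)) (PiE {i, j, k} (\<lambda>_. UNIV))" for i j k :: nat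
    by (rule inj_onI, erule (1) PiE_ext) auto
  have H1: "shannon_entropy M (X i) = ?h {i}" if "i \<in> N4" for i
    using H[OF _ inj1, of i] that by (simp add: subvector_def)
  have H2: "shannon_entropy M (\<lambda>\<omega>. (X i \<omega>, X j \<omega>)) = ?h {i, j}"
    if "i \<in> N4" "j \<in> N4" for i j
    using H[OF _ inj2, of i j] that by (simp add: subvector_def)
  have H3: "shannon_entropy M (\<lambda>\<omega>. ((X i \<omega>, X j \<omega>), X k \<omega>)) = ?h {i, j, k}"
    if "i \<in> N4" "j \<in> N4" "k \<in> N4" for i j k
    using H[OF _ inj3, of i j k] that by (simp add: subvector_def)
  note rank = face_point_def Uhat35_rank_def uniform_rank_def Int_insert_left E
  have "\<exists>v::nat. 1 \<le> v \<and> shannon_entropy M (X 3) = log 2 (real v)"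
    unfolding shannon_entropy_def
    by (rule entropy_eq_log_nat[of "X 1" "X 3" "X 4"], unfold shannon_entropy_def[symmetric])
      (simp_all add: X H1 H2 H3 rank)
  moreover have "shannon_entropy M (X 3) = a" by (simp add: H1 rank)
  ultimately show ?thesis by simp
qed

section \<open>Realization by random variables\<close>

text \<open>Grouping the sample points by the value of Y turns the sum over values into a sum over
  points. Every subvector is then treated on the same index set, and only the masses of its fibres
  have to be computed.\<close>

lemma shannon_entropy_point_measure:
  fixes p :: "'a \<Rightarrow> real"
  assumes fin: "finite S" and nonneg: "\<And>s. s \<in> S \<Longrightarrow> 0 \<le> p s" and one: "sum p S = 1"
  shows "shannon_entropy (point_measure S p) Y
       = - (\<Sum>s\<in>S. p s * log 2 (\<Sum>t | t \<in> S \<and> Y t = Y s. p t))"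
proof -
  let ?M = "point_measure S (\<lambda>s. ennreal (p s))"
  interpret prob_space ?M
    by (rule prob_space_point_measure) (use assms in \<open>auto simp: sum_ennreal\<close>)
  interpret information_space ?M 2 by unfold_locales simp
  have space: "space ?M = S" by (simp add: space_point_measure)
  have sf: "simple_function ?M Y" using fin by simp
  have pr: "prob (Y -` {y} \<inter> S) = (\<Sum>t | t \<in> S \<and> Y t = y. p t)" for y
  proof -
    have "Y -` {y} \<inter> S = {t \<in> S. Y t = y}" by auto
    then show ?thesis
      using fin nonneg
        measure_point_measure_finite_if[where A = S and f = p and X = "{t \<in> S. Y t = y}"] by simp
  qed
  have "shannon_entropy ?M Y = - (\<Sum>y\<in>Y ` S. prob (Y -` {y} \<inter> S) * log 2 (prob (Y -` {y} \<inter> S)))"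
    using entropy_simple_distributed[OF simple_distributedI[OF sf measure_nonneg refl]]
    by (simp add: shannon_entropy_def space)
  also have "\<dots> = - (\<Sum>y\<in>Y ` S. \<Sum>s | s \<in> S \<and> Y s = y. p s * log 2 (\<Sum>t | t \<in> S \<and> Y t = Y s. p t))"
    unfolding pr sum_distrib_right by (intro arg_cong[where f = uminus] sum.cong) auto
  also have "\<dots> = - (\<Sum>s\<in>S. p s * log 2 (\<Sum>t | t \<in> S \<and> Y t = Y s. p t))"
    by (simp only: sum.image_gen[OF fin, of "\<lambda>s. p s * log 2 (\<Sum>t | t \<in> S \<and> Y t = Y s. p t)" Y])
  finally show ?thesis .
qed

section \<open>Distributions of prescribed entropy\<close>

text \<open>Intermediate value theorem along a segment of distributions whose entropy starts at 0
  and ends at a value that is at least b.\<close>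

lemma exists_distribution_with_entropy:
  fixes b :: real
  assumes "0 \<le> b"
  shows "\<exists>(n::nat) q. (\<forall>i<n. 0 \<le> q i) \<and> (\<Sum>i<n. q i) = 1 \<and> - (\<Sum>i<n. q i * log 2 (q i)) = b"
proof -
  define f where "f x = x * ln x" for x :: real
  \<comment> \<open>Chosen so that the uniform distribution on n points has entropy
    \<lceil>b\<rceil>, at least b.\<close>
  define n where "n = (2::nat) ^ nat \<lceil>b\<rceil>"
  have "b \<le> real (nat \<lceil>b\<rceil>)" by linarith
  also have "\<dots> = log 2 (real n)" by (simp add: n_def log_nat_power)
  finally have bn: "b \<le> log 2 (real n)" .
  have n: "1 \<le> n" by (simp add: n_def)
  \<comment> \<open>q t runs from a point mass (t = 0) to the uniform distribution on n points (t = 1).\<close>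
  define q where "q t i = (if i = 0 then 1 - t + t / real n else t / real n)" for t :: real and i :: nat
  define g where "g t = - (\<Sum>i<n. f (q t i)) / ln 2" for t
  \<comment> \<open>Only the endpoint 0 is delicate: there x ln x tends to 0 from the right, which
    agrees with the value 0 given by the factor x.\<close>
  have f: "continuous_on {0..} f"
  proof (rule continuous_on_eq_continuous_within[THEN iffD2], rule ballI)
    fix x :: real assume x: "x \<in> {0..}"
    show "continuous (at x within {0..}) f"
    proof (cases "x = 0")
      case True
      have "(f \<longlongrightarrow> 0) (at_right 0)" unfolding f_def by real_asymp
      then have "(f \<longlongrightarrow> 0) (at 0 within {0<..})" by simp
      moreover have "at (0::real) within {0..} = at 0 within {0<..}"
        by (rule at_within_nhd[of _ UNIV]) auto
      ultimately show ?thesis using True by (simp add: continuous_within f_def)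
    next
      case False
      then show ?thesis using x unfolding f_def
        by (intro continuous_intros) auto
    qed
  qed
  have q0: "0 \<le> q t i" if "t \<in> {0..1}" for t i using that by (simp add: q_def)
  have "continuous_on {0..1} g"
    unfolding g_def
  proof (intro continuous_intros continuous_on_compose2[OF f])
    show "continuous_on {0..1} (\<lambda>t. q t i)" for i
      by (cases "i = 0") (auto simp: q_def divide_inverse intro!: continuous_intros)
  qed (use q0 in auto)
  moreover have "g 0 = 0"
  proof -
    have "f (q 0 i) = 0" for i by (simp add: q_def f_def)
    then show ?thesis by (simp add: g_def)
  qed
  moreover have "g 1 = log 2 (real n)"
  proof -
    have "f (q 1 i) = - (ln (real n) / real n)" for i
      using n by (simp add: q_def f_def ln_div)
    then show ?thesis using n by (simp add: g_def log_def)
  qed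
  ultimately obtain t where t: "t \<in> {0..1}" "g t = b"
    using IVT'[of g 0 b 1] assms bn by auto
  have "(\<Sum>i<n. q t i) = (\<Sum>i<n. t / real n + (if i = 0 then 1 - t else 0))"
    by (intro sum.cong) (auto simp: q_def)
  also have "\<dots> = 1" using n by (simp add: sum.distrib)
  finally have "(\<Sum>i<n. q t i) = 1" .
  moreover have "- (\<Sum>i<n. q t i * log 2 (q t i)) = g t"
    by (simp add: g_def f_def log_def sum_divide_distrib)
  ultimately show ?thesis using q0[OF t(1)] t(2) by blast
qed

section \<open>The realization of the rank function of Uhat over Z/v\<close>

text \<open>The group (Z/v)^3 by least representatives; each index is that of the variable that
  reads off the coordinate.\<close>

definition cube :: "nat \<Rightarrow> (nat \<Rightarrow> int) set" where
  "cube v = PiE {2, 3, 4} (\<lambda>_. {0..<int v})"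

text \<open>The constant 0 is padding that gives all four variables the same value type.\<close>

definition coord :: "nat \<Rightarrow> nat \<Rightarrow> (nat \<Rightarrow> int) \<Rightarrow> int \<times> int" where
  "coord v i x = (if i = 1 then ((x 2 - x 3) mod int v, (x 2 - x 4) mod int v) else (x i, 0))"

lemma finite_cube: "finite (cube v)"
  by (auto simp: cube_def intro!: finite_PiE)

lemma card_cube: "card (cube v) = v ^ 3"
  by (simp add: cube_def card_PiE power3_eq_cube)

text \<open>Fixing both differences leaves only a common shift of the three coordinates, so the
  fibre is a coset of the diagonal subgroup.\<close>

lemma coord_1_shift:
  assumes v: "1 \<le> v" and x: "x \<in> cube v"
  shows "{y \<in> cube v. coord v 1 y = coord v 1 x}
       = (\<lambda>c. \<lambda>i\<in>{2, 3, 4}. (x i + c) mod int v) ` {0..<int v}" (is "?L = ?sh ` _")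
proof (intro equalityI subsetI)
  fix y assume y: "y \<in> ?L"
  define c where "c = (y 2 - x 2) mod int v"
  have "y = ?sh c"
  proof (rule PiE_ext)
    show "y \<in> PiE {2, 3, 4} (\<lambda>_. UNIV)" "?sh c \<in> PiE {2, 3, 4} (\<lambda>_. UNIV)"
      using y by (auto simp: cube_def)
    fix i :: nat assume i: "i \<in> {2, 3, 4}"
    \<comment> \<open>For i = 3, 4 these are the two components of \<open>coord v 1\<close>; for i =
      2 both sides are 0.\<close>
    have "(y 2 - y i) mod int v = (x 2 - x i) mod int v"
      using y i by (auto simp: coord_def)
    then have "int v dvd (y 2 - y i) - (x 2 - x i)" by (simp add: mod_eq_dvd_iff)
    also have "(y 2 - y i) - (x 2 - x i) = (x i + (y 2 - x 2)) - y i" by simp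
    finally have "(x i + (y 2 - x 2)) mod int v = y i mod int v" by (simp only: mod_eq_dvd_iff)
    also have "y i mod int v = y i" using y i by (auto simp: cube_def PiE_iff)
    finally show "y i = ?sh c i" using i by (simp add: c_def mod_add_right_eq)
  qed
  moreover have "c \<in> {0..<int v}" using v by (simp add: c_def)
  ultimately show "y \<in> ?sh ` {0..<int v}" by blast
next
  fix y assume "y \<in> ?sh ` {0..<int v}"
  then obtain c where y: "y = ?sh c" by blast
  have "(y 2 - y i) mod int v = (x 2 - x i) mod int v" if "i \<in> {2, 3, 4}" for i
    using that by (simp add: y mod_diff_eq)
  then have "coord v 1 y = coord v 1 x" by (simp add: coord_def)
  moreover have "y \<in> cube v" using v by (auto simp: y cube_def)
  ultimately show "y \<in> ?L" by simp
qed

lemma inj_on_shift: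
  "inj_on (\<lambda>c. \<lambda>i\<in>{2, 3, 4::nat}. (x i + c) mod int v) {0..<int v}"
proof (rule inj_onI)
  fix c d
  assume cd: "c \<in> {0..<int v}" "d \<in> {0..<int v}"
    and "(\<lambda>i\<in>{2, 3, 4}. (x i + c) mod int v) = (\<lambda>i\<in>{2, 3, 4}. (x i + d) mod int v)"
  then have "(x 2 + c) mod int v = (x 2 + d) mod int v" by (auto dest: fun_cong[of _ _ 2])
  then have "c mod int v = d mod int v" by (simp add: mod_eq_dvd_iff)
  then show "c = d" using cd by simp
qed

text \<open>These fibre sizes say that, on the uniform space cube v, the variables coord v i have
  entropy function log v times the rank function of Uhat.\<close>

lemma card_coord_fibre:
  assumes v: "1 \<le> v" and x: "x \<in> cube v" and A: "A \<subseteq> N4"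
  shows "real (card {y \<in> cube v. \<forall>i\<in>A. coord v i y = coord v i x}) * real v powr Uhat35_rank 1 A
       = real v ^ 3"
proof (cases "1 \<in> A")
  case False
  have A': "A \<subseteq> {2, 3, 4}" using A False by auto
  have fin234: "finite {2, 3, 4::nat}" by simp
  have fA: "finite A" by (rule finite_subset[OF A']) simp
  have coord_eq: "coord v i y = coord v i x \<longleftrightarrow> y i = x i" if "i \<in> A" for i y
  proof -
    have "i \<noteq> 1" using that False by metis
    then show ?thesis by (simp add: coord_def)
  qed
  have bound: "x i \<in> {0..<int v}" if "i \<in> {2, 3, 4}" for i
    using x that unfolding cube_def by (rule PiE_mem)
  \<comment> \<open>The coordinates in A are pinned and the others are free, so the fibre is a box
    with v ^ (3 - |A|) points.\<close>
  have "{y \<in> cube v. \<forall>i\<in>A. coord v i y = coord v i x}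
      = PiE {2, 3, 4} (\<lambda>i. if i \<in> A then {x i} else {0..<int v})"
  proof (intro equalityI subsetI)
    fix y assume "y \<in> {y \<in> cube v. \<forall>i\<in>A. coord v i y = coord v i x}"
    then have y: "y \<in> PiE {2, 3, 4} (\<lambda>_. {0..<int v})" "\<And>i. i \<in> A \<Longrightarrow> y i = x i"
      by (simp_all add: cube_def coord_eq)
    show "y \<in> PiE {2, 3, 4} (\<lambda>i. if i \<in> A then {x i} else {0..<int v})"
    proof (rule PiE_I)
      show "y i \<in> (if i \<in> A then {x i} else {0..<int v})" if "i \<in> {2, 3, 4}" for i
        using PiE_mem[OF y(1) that] y(2)[of i] by simp
    qed (rule PiE_arb[OF y(1)])
  next
    fix y assume y: "y \<in> PiE {2, 3, 4} (\<lambda>i. if i \<in> A then {x i} else {0..<int v})"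
    have yA: "y i = x i" if "i \<in> A" for i
      using PiE_mem[OF y subsetD[OF A' that]] that by simp
    have "y \<in> cube v"
      unfolding cube_def
    proof (rule PiE_I)
      show "y i \<in> {0..<int v}" if "i \<in> {2, 3, 4}" for i
        using PiE_mem[OF y that] bound[OF that] by (cases "i \<in> A") simp_all
    qed (rule PiE_arb[OF y])
    with yA show "y \<in> {y \<in> cube v. \<forall>i\<in>A. coord v i y = coord v i x}"
      by (simp add: coord_eq)
  qed
  also have "card \<dots> = (\<Prod>i\<in>{2, 3, 4}. if i \<in> A then 1 else v)"
    unfolding card_PiE[OF fin234]
    by (rule prod.cong) simp_all
  also have "\<dots> = v ^ card ({2, 3, 4} - A)"
    by (subst prod.If_cases) (simp_all add: Diff_eq[symmetric] Collect_neg_eq)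
  also have "card ({2, 3, 4} - A) = 3 - card A"
    using card_Diff_subset[OF fA A'] by simp
  finally show ?thesis
    using v card_mono[OF _ A'] False
    by (simp add: Uhat35_rank_def powr_realpow power_add[symmetric])
next
  case True
  show ?thesis
  proof (cases "A = {1}")
    case True
    then have "card {y \<in> cube v. \<forall>i\<in>A. coord v i y = coord v i x} = v"
      using coord_1_shift[OF v x] by (simp add: card_image[OF inj_on_shift])
    then show ?thesis
      using v True by (simp add: Uhat35_rank_def power3_eq_cube power2_eq_square)
  next
    case False
    then obtain j where j: "j \<in> A" "j \<noteq> 1" using True by blast
    have j': "j \<in> {2, 3, 4}" using j A by auto
    \<comment> \<open>Agreement at 1 makes y a common shift of x, and agreement at j forces that
      shift to be 0.\<close>
    have "y = x" if y: "y \<in> cube v" "\<forall>i\<in>A. coord v i y = coord v i x" for y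
    proof -
      have "y \<in> {y \<in> cube v. coord v 1 y = coord v 1 x}" using y True by simp
      then obtain c where c: "c \<in> {0..<int v}" "y = (\<lambda>i\<in>{2, 3, 4}. (x i + c) mod int v)"
        unfolding coord_1_shift[OF v x] by blast
      have x_mod: "x i mod int v = x i" if "i \<in> {2, 3, 4}" for i
        using PiE_mem[OF x[unfolded cube_def] that] by simp
      have "y j = x j" using y(2) j by (auto simp: coord_def)
      then have "(x j + c) mod int v = x j mod int v"
        using j' by (simp only: c(2) restrict_apply' x_mod)
      then have "c mod int v = 0" by (simp add: mod_eq_dvd_iff mod_eq_0_iff_dvd)
      then have "c = 0" using c(1) by simp
      show "y = x"
      proof (rule PiE_ext[OF y(1)[unfolded cube_def] x[unfolded cube_def]])
        show "y i = x i" if "i \<in> {2, 3, 4}" for i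
          using that by (simp only: c(2) restrict_apply' x_mod \<open>c = 0\<close> add_0_right)
      qed
    qed
    then have "{y \<in> cube v. \<forall>i\<in>A. coord v i y = coord v i x} = {x}" using x by blast
    \<comment> \<open>Here \<open>min 3 (card A + 1)\<close> reaches 3, matching a fibre with one
      point.\<close>
    moreover have "2 \<le> card A"
      using card_mono[of A "{1, j}"] j True A finite_subset[OF A] by simp
    ultimately show ?thesis
      using v True by (simp add: Uhat35_rank_def)
  qed
qed

section \<open>Adjoining an independent variable of entropy b\<close>

text \<open>On the product of the uniform cube with a distribution q of entropy b, fibres of
  subvectors are products. Their masses factor, and the logarithm adds the two
  contributions.\<close>

lemma entropic_face_point:
  assumes v: "1 \<le> v" and b: "0 \<le> b"
  shows "entropic (face_point (Uhat35_rank 1) (uniform_rank 1 E) (log 2 (real v)) b)"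
proof -
  obtain n :: nat and q where q: "\<And>i. i < n \<Longrightarrow> 0 \<le> q i" "(\<Sum>i<n. q i) = 1"
    and b_eq: "- (\<Sum>i<n. q i * log 2 (q i)) = b"
    using exists_distribution_with_entropy[OF b] by blast
  define S where "S = cube v \<times> {..<n}"
  define p where "p s = q (snd s) / real v ^ 3" for s :: "(nat \<Rightarrow> int) \<times> nat"
  define X where "X i s = (coord v i (fst s), if i \<in> E then snd s else 0)"
    for i and s :: "(nat \<Rightarrow> int) \<times> nat"
  define M where "M = point_measure S (\<lambda>s. ennreal (p s))"
  have S: "finite S" by (simp add: S_def finite_cube)
  have p: "0 \<le> p s" if "s \<in> S" for s
    using that q(1) by (auto simp: p_def S_def)
  \<comment> \<open>Summing over the v ^ 3 points of the cube cancels the uniform weight.\<close>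
  have marginal: "(\<Sum>s\<in>S. p s * f (snd s)) = (\<Sum>w<n. q w * f w)" for f :: "nat \<Rightarrow> real"
  proof -
    have "(\<Sum>s\<in>S. p s * f (snd s)) = (\<Sum>x\<in>cube v. \<Sum>w<n. q w / real v ^ 3 * f w)"
      unfolding sum.cartesian_product by (simp add: S_def p_def case_prod_unfold)
    also have "\<dots> = (\<Sum>w<n. q w * f w)"
      using v by (simp add: card_cube sum_distrib_left)
    finally show ?thesis .
  qed
  have one: "sum p S = 1" using marginal[of "\<lambda>_. 1"] q(2) by simp
  have "shannon_entropy M (subvector X A) = face_point (Uhat35_rank 1) (uniform_rank 1 E) (log 2 (real v)) b A"
    if A: "A \<subseteq> N4" for A
  proof -
    have fin: "finite A" by (rule finite_subset[OF A]) simp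
    let ?\<rho> = "Uhat35_rank 1 A"
    have fibre: "(\<Sum>t | t \<in> S \<and> subvector X A t = subvector X A s. p t)
        = (if A \<inter> E = {} then 1 else q (snd s)) / real v powr ?\<rho>" if s: "s \<in> S" for s
    proof -
      let ?F = "{y \<in> cube v. \<forall>i\<in>A. coord v i y = coord v i (fst s)}"
      have sum_fibre: "(\<Sum>t\<in>F \<times> W. q (snd t)) = real (card F) * (\<Sum>w\<in>W. q w)"
        for F :: "(nat \<Rightarrow> int) set" and W
        using sum.cartesian_product[of "\<lambda>_. q" W F] by (simp add: case_prod_unfold)
      \<comment> \<open>The second component is visible to the subvector exactly when A meets
        E.\<close>
      let ?W = "if A \<inter> E = {} then {..<n} else {snd s}"
      have "{t \<in> S. subvector X A t = subvector X A s} = ?F \<times> ?W"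
        using s by (auto simp: S_def subvector_def X_def restrict_def fun_eq_iff)
      then have "(\<Sum>t | t \<in> S \<and> subvector X A t = subvector X A s. p t)
          = real (card ?F) * (\<Sum>w\<in>?W. q w) / real v ^ 3"
        by (simp add: p_def sum_fibre sum_divide_distrib[symmetric])
      also have "(\<Sum>w\<in>?W. q w) = (if A \<inter> E = {} then 1 else q (snd s))"
        using q(2) by simp
      \<comment> \<open>Rewriting the denominator lets the number of cube points in the fibre
        cancel.\<close>
      also have "real v ^ 3 = real (card ?F) * real v powr ?\<rho>"
        by (rule card_coord_fibre[symmetric]) (use v A s in \<open>auto simp: S_def\<close>)
      moreover have "real (card ?F) \<noteq> 0"
        using s finite_cube[of v] by (auto simp: S_def card_eq_0_iff)
      ultimately show ?thesis by simp
    qed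
    define e where "e = (if A \<inter> E = {} then 0 else 1 :: real)"
    have "p s * log 2 (\<Sum>t | t \<in> S \<and> subvector X A t = subvector X A s. p t)
        = p s * (e * log 2 (q (snd s)) - ?\<rho> * log 2 (real v))" if s: "s \<in> S" for s
    \<comment> \<open>If q vanishes at the second component, so does the weight \<open>p s\<close>,
      and the value of the logarithm at 0 is irrelevant.\<close>
    proof (cases "q (snd s) = 0")
      case False
      then have "0 < q (snd s)" using q(1) s by (auto simp: S_def less_le)
      then show ?thesis unfolding fibre[OF s] using v
        by (simp add: e_def log_divide log_powr)
    qed (simp add: p_def)
    then have "(\<Sum>s\<in>S. p s * log 2 (\<Sum>t | t \<in> S \<and> subvector X A t = subvector X A s. p t))
        = (\<Sum>s\<in>S. p s * (e * log 2 (q (snd s)) - ?\<rho> * log 2 (real v)))"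
      by (rule sum.cong[OF refl])
    then have "shannon_entropy M (subvector X A)
        = - (\<Sum>s\<in>S. p s * (e * log 2 (q (snd s)) - ?\<rho> * log 2 (real v)))"
      by (simp only: M_def shannon_entropy_point_measure[OF S p one])
    also have "\<dots> = - (\<Sum>w<n. q w * (e * log 2 (q w) - ?\<rho> * log 2 (real v)))"
      by (simp only: marginal[of "\<lambda>w. e * log 2 (q w) - ?\<rho> * log 2 (real v)"])
    also have "\<dots> = e * - (\<Sum>w<n. q w * log 2 (q w)) + (\<Sum>w<n. q w) * (?\<rho> * log 2 (real v))"
      by (simp add: algebra_simps sum_subtractf sum_distrib_left sum_distrib_right)
    also have "\<dots> = e * b + ?\<rho> * log 2 (real v)"
      by (simp only: b_eq q(2) mult_1_left)
    also have "e = uniform_rank 1 E A"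
      using fin by (auto simp: e_def uniform_rank_def card_gt_0_iff Suc_le_eq min_def)
    finally show ?thesis by (simp add: face_point_def mult.commute)
  qed
  moreover have "prob_space M"
    unfolding M_def by (rule prob_space_point_measure) (use S p one in \<open>auto simp: sum_ennreal\<close>)
  moreover have "simple_function M (X i)" for i using S by (simp add: M_def)
  ultimately have "entropy_function_of M X (face_point (Uhat35_rank 1) (uniform_rank 1 E) (log 2 (real v)) b)"
    by (simp add: entropy_function_of_def)
  then show ?thesis by (rule entropy_function_of_imp_entropic)
qed

theorem mainTheorem8:
  fixes r1 r2 :: "nat set \<Rightarrow> real" and a b :: real
  assumes "(r1, r2) \<in> {(Uhat35_rank 1, uniform_rank 1 {1}),
                        (Uhat35_rank 1, uniform_rank 1 {2}),
                        (Uhat35_rank 1, uniform_rank 1 {1, 2})}"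
    and "a \<ge> 0" and "b \<ge> 0"
  shows "entropic (face_point r1 r2 a b) \<longleftrightarrow> (\<exists>v :: nat. v \<ge> 1 \<and> a = log 2 (real v))"
proof
  assume ent: "entropic (face_point r1 r2 a b)"
  \<comment> \<open>All three faces have a second generator of the form min(1, |A \<inter> E|), with
    E equal to {1}, {2} or {1, 2}.\<close>
  obtain E where "r1 = Uhat35_rank 1" "r2 = uniform_rank 1 E" "3 \<notin> E" "4 \<notin> E"
    using assms(1) by auto
  with entropic_imp_log_nat[of E a b] ent show "\<exists>v :: nat. v \<ge> 1 \<and> a = log 2 (real v)"
    by blast
next
  assume "\<exists>v :: nat. v \<ge> 1 \<and> a = log 2 (real v)"
  moreover obtain E where "r1 = Uhat35_rank 1" "r2 = uniform_rank 1 E"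
    using assms(1) by auto
  ultimately show "entropic (face_point r1 r2 a b)"
    using entropic_face_point[OF _ assms(3)] by blast
qed

end
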